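(* A quiver that contains a vortex has no proper cyclic ordering.
   Context: A quiver is a finite directed graph without loops or oriented 2-cycles; multiple arrows are allowed. A quiver is complete if each pair of its vertices is connected by at least one arrow (in one of the two directions). A vortex is a complete 4-vertex quiver such that one of its vertices is a source or a sink, and the remaining three vertices support an oriented 3-cycle. A quiver contains a vortex if one of its full (induced) 4-vertex subquivers is a vortex. A cyclic ordering $\sigma=(v_1,\dots,v_n)$ of the vertex set is a linear ordering considered up to cyclic shifts ("clockwise" placement on a circle). A cyclically ordered quiver (COQ) $(Q,\sigma)$ is a quiver with a cyclic ordering of its vertices. A wiggle transforms $(Q,\sigma)$ into $(Q,\sigma')$ where $\sigma'$ is obtained from $\sigma$ by interchanging two vertices that are consecutive in $\sigma$ and not adjacent in $Q$. Wiggle equivalence is the equivalence relation generated by wiggles. A path $i\to j\to k$ in $Q$ makes a right turn at $j$ if $\sigma=(\dots,i,\dots,j,\dots,k,\dots)$. A vertex $j$ is proper in $(Q,\sigma)$ if every oriented two-arrow path $i\to j\to k$ in $Q$ makes a right turn at $j$. A COQ $(Q,\sigma)$ is proper if for every vertex $j$ there is a COQ wiggle equivalent to $(Q,\sigma)$ (possibly depending on $j$) in which $j$ is proper. A proper cyclic ordering of $Q$ is a cyclic ordering $\sigma$ such that $(Q,\sigma)$ is proper. *)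

theory Defs
  imports
    "Graph_Theory.Digraph_Component"
    "HOL-Combinatorics.Multiset_Permutations"
    "HOL-Library.Sublist"
begin

section \<open>Quivers and vortices\<close>

locale quiver = fin_digraph + loopfree_digraph +
  assumes no_2_cycles: "u \<rightarrow>\<^bsub>G\<^esub> v \<Longrightarrow> \<not> v \<rightarrow>\<^bsub>G\<^esub> u"

definition adjacent :: "('a, 'b) pre_digraph \<Rightarrow> 'a \<Rightarrow> 'a \<Rightarrow> bool" where
  "adjacent Q u v \<longleftrightarrow> u \<rightarrow>\<^bsub>Q\<^esub> v \<or> v \<rightarrow>\<^bsub>Q\<^esub> u"

definition complete_quiver :: "('a, 'b) pre_digraph \<Rightarrow> bool" where
  "complete_quiver Q \<longleftrightarrow>
     quiver Q \<and> (\<forall>u \<in> verts Q. \<forall>v \<in> verts Q. u \<noteq> v \<longrightarrow> adjacent Q u v)"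

definition source :: "('a, 'b) pre_digraph \<Rightarrow> 'a \<Rightarrow> bool" where
  "source Q v \<longleftrightarrow> v \<in> verts Q \<and> in_arcs Q v = {}"

definition sink :: "('a, 'b) pre_digraph \<Rightarrow> 'a \<Rightarrow> bool" where
  "sink Q v \<longleftrightarrow> v \<in> verts Q \<and> out_arcs Q v = {}"

definition vortex :: "('a, 'b) pre_digraph \<Rightarrow> bool" where
  "vortex Q \<longleftrightarrow>
     complete_quiver Q \<and> card (verts Q) = 4 \<and>
     (\<exists>v a b c. (source Q v \<or> sink Q v) \<and>
        distinct [v, a, b, c] \<and> verts Q = {v, a, b, c} \<and>
        a \<rightarrow>\<^bsub>Q\<^esub> b \<and> b \<rightarrow>\<^bsub>Q\<^esub> c \<and> c \<rightarrow>\<^bsub>Q\<^esub> a)"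

definition contains_vortex :: "('a, 'b) pre_digraph \<Rightarrow> bool" where
  "contains_vortex Q \<longleftrightarrow> (\<exists>H. induced_subgraph H Q \<and> vortex H)"

section \<open>Cyclically ordered quivers\<close>

text \<open>
  A linear ordering of \<open>V\<close> is a duplicate-free list with set of elements \<open>V\<close>;
  a cyclic ordering is its class modulo cyclic shifts, i.e. the set of
  all lists obtained from it by rotation.
\<close>

definition cyclic_shift :: "('a list \<times> 'a list) set" where
  "cyclic_shift = {(xs, ys). \<exists>n. ys = rotate n xs}"

definition cyclic_orderings :: "'a set \<Rightarrow> 'a list set set" where
  "cyclic_orderings V = permutations_of_set V // cyclic_shift"

definition coq :: "('a, 'b) pre_digraph \<Rightarrow> 'a list set \<Rightarrow> bool" where
  "coq Q \<sigma> \<longleftrightarrow> quiver Q \<and> \<sigma> \<in> cyclic_orderings (verts Q)"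

text \<open>
  Since \<open>\<sigma>\<close> is closed under rotation, two vertices are consecutive in \<open>\<sigma>\<close>
  (possibly across the end of a representing list) iff they are the first two
  entries of some representative. A wiggle does not change the quiver,
  so it is a relation on cyclic orderings for fixed \<open>Q\<close>.
\<close>

definition wiggle :: "('a, 'b) pre_digraph \<Rightarrow> 'a list set \<Rightarrow> 'a list set \<Rightarrow> bool" where
  "wiggle Q \<sigma> \<sigma>' \<longleftrightarrow>
     coq Q \<sigma> \<and>
     (\<exists>u v ws. u # v # ws \<in> \<sigma> \<and> \<not> adjacent Q u v \<and> \<sigma>' = cyclic_shift `` {v # u # ws})"

definition wiggle_equivalent ::
    "('a, 'b) pre_digraph \<Rightarrow> 'a list set \<Rightarrow> 'a list set \<Rightarrow> bool" where
  "wiggle_equivalent Q = equivclp (wiggle Q)"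

text \<open>
  \<open>\<sigma> = (\<dots>, i, \<dots>, j, \<dots>, k, \<dots>)\<close> holds up to cyclic shifts, so it suffices that
  some representative has this form.
\<close>

definition right_turn :: "'a list set \<Rightarrow> 'a \<Rightarrow> 'a \<Rightarrow> 'a \<Rightarrow> bool" where
  "right_turn \<sigma> i j k \<longleftrightarrow> (\<exists>xs \<in> \<sigma>. subseq [i, j, k] xs)"

definition proper_vertex :: "('a, 'b) pre_digraph \<Rightarrow> 'a list set \<Rightarrow> 'a \<Rightarrow> bool" where
  "proper_vertex Q \<sigma> j \<longleftrightarrow>
     (\<forall>i k. i \<rightarrow>\<^bsub>Q\<^esub> j \<and> j \<rightarrow>\<^bsub>Q\<^esub> k \<longrightarrow> right_turn \<sigma> i j k)"

definition proper_coq :: "('a, 'b) pre_digraph \<Rightarrow> 'a list set \<Rightarrow> bool" where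
  "proper_coq Q \<sigma> \<longleftrightarrow>
     coq Q \<sigma> \<and>
     (\<forall>j \<in> verts Q. \<exists>\<sigma>'. wiggle_equivalent Q \<sigma> \<sigma>' \<and> proper_vertex Q \<sigma>' j)"

definition proper_cyclic_ordering :: "('a, 'b) pre_digraph \<Rightarrow> 'a list set \<Rightarrow> bool" where
  "proper_cyclic_ordering Q \<sigma> \<longleftrightarrow> \<sigma> \<in> cyclic_orderings (verts Q) \<and> proper_coq Q \<sigma>"

end

theory Submission
  imports Defs
begin

text \<open>
  A wiggle interchanges two non-adjacent vertices, so it cannot change the cyclic order of three
  pairwise adjacent ones. In a proper ordering, every two-arrow path inside a complete subquiver
  therefore makes a right turn in the given ordering itself. If \<open>v\<close> is a source or a sink over the
  oriented cycle \<open>a \<rightarrow> b \<rightarrow> c \<rightarrow> a\<close>, reading the circle clockwise from \<open>v\<close> would thus place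
  \<open>a\<close> before \<open>b\<close>, \<open>b\<close> before \<open>c\<close> and \<open>c\<close> before \<open>a\<close>.
\<close>

section \<open>Representatives of cyclic orderings\<close>

lemma equiv_cyclic_shift: "equiv UNIV (cyclic_shift :: ('a list \<times> 'a list) set)"
  (is "equiv UNIV ?R")
proof (rule equivI)
  show "refl_on UNIV ?R"
    by (auto simp: refl_on_def cyclic_shift_def intro: exI[of _ 0])
  show "sym ?R"
  proof (rule symI)
    fix xs ys :: "'a list"
    assume "(xs, ys) \<in> cyclic_shift"
    then obtain n where "ys = rotate n xs"
      by (auto simp: cyclic_shift_def)
    \<comment> \<open>Reducing the shift modulo the length makes the complementary shift
      \<open>length xs - n mod length xs\<close> an untruncated subtraction, and this shift undoes
      the first one.\<close>
    then have "ys = rotate (n mod length xs) xs"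
      by (simp only: rotate_conv_mod[symmetric])
    then have "rotate (length xs - n mod length xs) ys = xs"
      by (cases "xs = []") (simp_all add: rotate_rotate less_imp_le)
    from this[symmetric] have "\<exists>m. xs = rotate m ys" ..
    then show "(ys, xs) \<in> cyclic_shift"
      by (simp add: cyclic_shift_def)
  qed
  show "trans ?R"
    by (auto simp: trans_def cyclic_shift_def rotate_rotate)
qed simp

lemma append_swap_in_cyclic_shift: "(xs @ ys, ys @ xs) \<in> cyclic_shift"
  by (auto simp: cyclic_shift_def rotate_append intro!: exI[of _ "length xs"])

lemma cyclic_orderings_representative:
  assumes "\<sigma> \<in> cyclic_orderings V" "xs \<in> \<sigma>"
  shows "\<sigma> = cyclic_shift `` {xs}" "distinct xs" "set xs = V"
proof -
  obtain ys where ys: "ys \<in> permutations_of_set V" "\<sigma> = cyclic_shift `` {ys}"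
    using assms(1) by (auto simp: cyclic_orderings_def elim: quotientE)
  then have *: "(ys, xs) \<in> cyclic_shift"
    using assms(2) by auto
  then show "\<sigma> = cyclic_shift `` {xs}"
    using ys(2) equiv_class_eq[OF equiv_cyclic_shift] by blast
  show "distinct xs" "set xs = V"
    using * ys(1) by (auto simp: cyclic_shift_def permutations_of_set_def)
qed

text \<open>The circle is cut open just before \<open>v\<close>.\<close>

lemma cyclic_orderings_Cons:
  assumes "\<sigma> \<in> cyclic_orderings V" "v \<in> V"
  obtains ws where "\<sigma> = cyclic_shift `` {v # ws}" "distinct (v # ws)"
proof -
  obtain xs where "xs \<in> permutations_of_set V" and \<sigma>: "\<sigma> = cyclic_shift `` {xs}"
    using assms(1) by (auto simp: cyclic_orderings_def elim: quotientE)
  then obtain ys zs where "xs = ys @ v # zs"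
    using assms(2) by (metis permutations_of_setD(1) split_list)
  then have "v # zs @ ys \<in> \<sigma>"
    using append_swap_in_cyclic_shift[of ys "v # zs"] \<sigma> by simp
  then show thesis
    using cyclic_orderings_representative[OF assms(1)] that by blast
qed

section \<open>Subsequences and right turns\<close>

lemma subseq_set_mono: "subseq xs ys \<Longrightarrow> set xs \<subseteq> set ys"
  by (metis notin_set_nthsI subseq_conv_nths subsetI)

text \<open>Filtering preserves the embedding of \<open>ys\<close>, and distinctness leaves no room
  for further entries, so the lengths agree. This replaces an embedding by an equation that can be
  computed.\<close>

lemma subseq_iff_filter:
  assumes "distinct xs" "distinct ys"
  shows "subseq ys xs \<longleftrightarrow> filter (\<lambda>x. x \<in> set ys) xs = ys"
proof
  assume sub: "subseq ys xs"
  let ?f = "filter (\<lambda>x. x \<in> set ys)"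
  have "subseq (?f ys) (?f xs)"
    using sub by (rule subseq_filter)
  then have "subseq ys (?f xs)"
    by simp
  moreover have "length (?f xs) = length ys"
  proof -
    have "set (?f xs) = set ys"
      using subseq_set_mono[OF sub] by auto
    then show ?thesis
      using assms by (metis distinct_card distinct_filter)
  qed
  ultimately show "?f xs = ys"
    by (metis subseq_same_length)
qed (metis subseq_filter_left)

text \<open>Lifts a cut of the filtered list to the full list, so that a rotation of the former
  comes from a rotation of the latter.\<close>

lemma filter_eq_appendE:
  assumes "filter P xs = us @ vs"
  obtains ys zs where "xs = ys @ zs" "filter P ys = us" "filter P zs = vs"
  using assms
proof (induction us arbitrary: xs thesis)
  case Nil
  show ?case
    using Nil.prems(1)[of "[]" xs] Nil.prems(2) by simp
next
  case (Cons u us)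
  then obtain as bs where xs: "xs = as @ u # bs" "\<forall>x \<in> set as. \<not> P x" "P u" "filter P bs = us @ vs"
    by (auto dest!: filter_eq_ConsD)
  obtain ys zs where "bs = ys @ zs" "filter P ys = us" "filter P zs = vs"
    using Cons.IH xs(4) by blast
  then show ?case
    using Cons.prems(1)[of "as @ u # ys" zs] xs by simp
qed

text \<open>A rotation swaps the two blocks of a cut, and filtering respects cuts. So the turn
  depends only on the cyclic order of the three entries that survive in any one
  representative.\<close>

lemma right_turn_iff_filter:
  assumes "distinct xs" "distinct [i, j, k]"
  shows "right_turn (cyclic_shift `` {xs}) i j k \<longleftrightarrow>
    filter (\<lambda>x. x \<in> {i, j, k}) xs \<in> {[i, j, k], [j, k, i], [k, i, j]}"
    (is "_ \<longleftrightarrow> ?f xs \<in> _")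
proof
  assume "right_turn (cyclic_shift `` {xs}) i j k"
  then obtain n where "subseq [i, j, k] (rotate n xs)"
    by (auto simp: right_turn_def cyclic_shift_def)
  then obtain ys zs where xs: "xs = ys @ zs" and "subseq [i, j, k] (zs @ ys)"
    by (metis append_take_drop_id rotate_drop_take)
  then have "?f (zs @ ys) = [i, j, k]"
    using assms subseq_iff_filter[of "zs @ ys" "[i, j, k]"] by auto
  then have "?f zs @ ?f ys = [i, j, k]"
    by simp
  then show "?f xs \<in> {[i, j, k], [j, k, i], [k, i, j]}"
    unfolding xs by (auto simp: append_eq_Cons_conv)
next
  assume "?f xs \<in> {[i, j, k], [j, k, i], [k, i, j]}"
  then have "\<exists>us vs. ?f xs = us @ vs \<and> vs @ us = [i, j, k]"
    \<comment> \<open>The witnesses for \<open>us\<close> are the blocks to be moved from the front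
      to the back: none, \<open>[j, k]\<close> and \<open>[k]\<close>.\<close>
    by (auto intro: exI[of _ "[]"] exI[of _ "[j, k]"] exI[of _ "[k]"])
  then obtain ys zs where "xs = ys @ zs" "?f zs @ ?f ys = [i, j, k]"
    by (metis filter_eq_appendE)
  then have "subseq [i, j, k] (zs @ ys)" "zs @ ys \<in> cyclic_shift `` {xs}"
    using subseq_filter_left[of "\<lambda>x. x \<in> {i, j, k}" "zs @ ys"] append_swap_in_cyclic_shift by auto
  then show "right_turn (cyclic_shift `` {xs}) i j k"
    by (auto simp: right_turn_def)
qed

lemma right_turn_rotate:
  assumes "\<sigma> \<in> cyclic_orderings V" "distinct [i, j, k]" "right_turn \<sigma> i j k"
  shows "right_turn \<sigma> k i j"
proof -
  obtain xs where \<sigma>: "\<sigma> = cyclic_shift `` {xs}" and xs: "distinct xs"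
    using assms(1,3) cyclic_orderings_representative by (metis right_turn_def)
  have kij: "distinct [k, i, j]" and eq: "{k, i, j} = {i, j, k}"
    using assms(2) by auto
  have "filter (\<lambda>x. x \<in> {i, j, k}) xs \<in> {[i, j, k], [j, k, i], [k, i, j]}"
    using assms(3) unfolding \<sigma> right_turn_iff_filter[OF xs assms(2)] .
  then show ?thesis
    unfolding \<sigma> right_turn_iff_filter[OF xs kij] eq by blast
qed

text \<open>With \<open>v\<close> at the head, the only possible rotation of the surviving triple is
  the one that starts with \<open>v\<close>.\<close>

lemma subseq_of_right_turn:
  assumes "right_turn (cyclic_shift `` {v # ws}) v a b" "distinct (v # ws)" "distinct [v, a, b]"
  shows "subseq [a, b] ws"
proof -
  have "filter (\<lambda>x. x \<in> {v, a, b}) ws = [a, b]"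
    using assms(1,3) right_turn_iff_filter[OF assms(2,3)] by auto
  then show ?thesis
    by (metis subseq_filter_left)
qed

lemma subseq_pairs_not_cyclic:
  assumes "distinct xs" "distinct [a, b, c]"
    and "subseq [a, b] xs" "subseq [b, c] xs" "subseq [c, a] xs"
  shows False
  using assms
proof (induction xs)
  case (Cons x xs)
  have "x \<noteq> a" "x \<noteq> b" "x \<noteq> c"
    using Cons.prems subseq_set_mono[of "[a, b]" xs] subseq_set_mono[of "[b, c]" xs]
      subseq_set_mono[of "[c, a]" xs] by (auto simp: subseq_Cons2_iff)
  then show ?case
    using Cons by (auto simp: subseq_Cons2_iff)
qed simp

lemma no_cyclic_right_turns:
  assumes "\<sigma> \<in> cyclic_orderings V" "v \<in> V" "distinct [v, a, b, c]"
    and "right_turn \<sigma> v a b" "right_turn \<sigma> v b c" "right_turn \<sigma> v c a"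
  shows False
proof -
  obtain ws where "\<sigma> = cyclic_shift `` {v # ws}" "distinct (v # ws)"
    using assms(1,2) by (rule cyclic_orderings_Cons)
  then show False
    using assms(3-6) subseq_of_right_turn[of v ws] subseq_pairs_not_cyclic[of ws a b c] by auto
qed

section \<open>Invariance of right turns on triangles under wiggles\<close>

definition pairwise_adjacent :: "('a, 'b) pre_digraph \<Rightarrow> 'a \<Rightarrow> 'a \<Rightarrow> 'a \<Rightarrow> bool" where
  "pairwise_adjacent Q i j k \<longleftrightarrow> distinct [i, j, k] \<and> adjacent Q i j \<and> adjacent Q j k \<and> adjacent Q i k"

lemma adjacent_commute: "adjacent Q u v \<longleftrightarrow> adjacent Q v u"
  by (auto simp: adjacent_def)

lemma wiggle_right_turn_iff:
  assumes "wiggle Q \<sigma> \<sigma>'" "pairwise_adjacent Q i j k"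
  shows "right_turn \<sigma> i j k \<longleftrightarrow> right_turn \<sigma>' i j k"
proof -
  obtain u v ws where uv: "\<sigma> \<in> cyclic_orderings (verts Q)" "u # v # ws \<in> \<sigma>" "\<not> adjacent Q u v"
    and \<sigma>': "\<sigma>' = cyclic_shift `` {v # u # ws}"
    using assms(1) by (auto simp: wiggle_def coq_def)
  then have \<sigma>: "\<sigma> = cyclic_shift `` {u # v # ws}" and d: "distinct (u # v # ws)"
    using cyclic_orderings_representative by metis+
  have ijk: "distinct [i, j, k]"
    using assms(2) by (simp add: pairwise_adjacent_def)
  \<comment> \<open>Any two entries of the triple are equal or adjacent; \<open>u\<close> and
    \<open>v\<close> are neither. So at most one of the swapped entries survives filtering.\<close>
  have "\<not> (u \<in> {i, j, k} \<and> v \<in> {i, j, k})"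
    using assms(2) uv(3) d by (auto simp: pairwise_adjacent_def adjacent_commute)
  then have "filter (\<lambda>x. x \<in> {i, j, k}) (u # v # ws) = filter (\<lambda>x. x \<in> {i, j, k}) (v # u # ws)"
    by auto
  moreover have "distinct (v # u # ws)"
    using d by auto
  ultimately show ?thesis
    unfolding \<sigma> \<sigma>' using right_turn_iff_filter d ijk by metis
qed

lemma wiggle_equivalent_right_turn_iff:
  assumes "wiggle_equivalent Q \<sigma> \<sigma>'" "pairwise_adjacent Q i j k"
  shows "right_turn \<sigma> i j k \<longleftrightarrow> right_turn \<sigma>' i j k"
  using assms(1) unfolding wiggle_equivalent_def
  by (induction rule: equivclp_induct) (use assms(2) wiggle_right_turn_iff in metis)+

text \<open>The ordering that makes \<open>j\<close> proper may vary with \<open>j\<close>;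
  invariance carries the turns back to the single ordering \<open>\<sigma>\<close>, where they can
  be compared.\<close>

lemma proper_coq_right_turn:
  assumes "proper_coq Q \<sigma>" "j \<in> verts Q" "i \<rightarrow>\<^bsub>Q\<^esub> j" "j \<rightarrow>\<^bsub>Q\<^esub> k" "adjacent Q i k" "distinct [i, j, k]"
  shows "right_turn \<sigma> i j k"
proof -
  obtain \<sigma>' where "wiggle_equivalent Q \<sigma> \<sigma>'" "right_turn \<sigma>' i j k"
    using assms by (auto simp: proper_coq_def proper_vertex_def)
  moreover have "pairwise_adjacent Q i j k"
    using assms by (simp add: pairwise_adjacent_def adjacent_def)
  ultimately show ?thesis
    using wiggle_equivalent_right_turn_iff by metis
qed

section \<open>Sources, sinks and the contradiction in a vortex\<close>

lemma source_dominates: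
  assumes "source Q v" "adjacent Q v x"
  shows "v \<rightarrow>\<^bsub>Q\<^esub> x"
  using assms by (auto simp: source_def adjacent_def arcs_ends_def arc_to_ends_def in_arcs_def)

lemma sink_dominated:
  assumes "sink Q v" "adjacent Q v x"
  shows "x \<rightarrow>\<^bsub>Q\<^esub> v"
  using assms by (auto simp: sink_def adjacent_def arcs_ends_def arc_to_ends_def out_arcs_def)

theorem corollary13p3:
  fixes Q :: "('a, 'b) pre_digraph"
  assumes "quiver Q"
    and "contains_vortex Q"
  shows "\<not> (\<exists>\<sigma>. proper_cyclic_ordering Q \<sigma>)"
proof
  assume "\<exists>\<sigma>. proper_cyclic_ordering Q \<sigma>"
  then obtain \<sigma> where \<sigma>: "\<sigma> \<in> cyclic_orderings (verts Q)" "proper_coq Q \<sigma>"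
    by (auto simp: proper_cyclic_ordering_def)
  obtain H where "induced_subgraph H Q" "vortex H"
    using assms(2) by (auto simp: contains_vortex_def)
  then have sub: "subgraph H Q"
    by auto
  obtain v a b c where v: "source H v \<or> sink H v" and d: "distinct [v, a, b, c]"
    and V: "verts H = {v, a, b, c}"
    and abc: "a \<rightarrow>\<^bsub>H\<^esub> b" "b \<rightarrow>\<^bsub>H\<^esub> c" "c \<rightarrow>\<^bsub>H\<^esub> a"
    using \<open>vortex H\<close> by (auto simp: vortex_def)
  have "complete_quiver H"
    using \<open>vortex H\<close> by (simp add: vortex_def)
  then have adj: "adjacent H x y" if "x \<in> verts H" "y \<in> verts H" "x \<noteq> y" for x y
    using that by (auto simp: complete_quiver_def)
  have arrow: "x \<rightarrow>\<^bsub>Q\<^esub> y" if "x \<rightarrow>\<^bsub>H\<^esub> y" for x y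
    using that sub by (rule pre_digraph.adj_mono)
  have turn: "right_turn \<sigma> x y z"
    if "x \<rightarrow>\<^bsub>H\<^esub> y" "y \<rightarrow>\<^bsub>H\<^esub> z" "distinct [x, y, z]" "{x, y, z} \<subseteq> verts H" for x y z
  proof (rule proper_coq_right_turn[OF \<sigma>(2)])
    show "y \<in> verts Q"
      using that(4) sub by auto
    \<comment> \<open>Completeness of \<open>H\<close> closes the path to a triangle, and the
      closing arrow persists in \<open>Q\<close>.\<close>
    show "adjacent Q x z"
      using adj[of x z] that(3,4) arrow by (auto simp: adjacent_def)
  qed (use that arrow in auto)
  \<comment> \<open>Both cases yield the same cyclic order: a source gives the path
    \<open>v\<close>, \<open>x\<close>, \<open>y\<close> turning at \<open>x\<close>; a sink gives
    \<open>x\<close>, \<open>y\<close>, \<open>v\<close> turning at \<open>y\<close>, which is then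
    rotated.\<close>
  have turn_v: "right_turn \<sigma> v x y" if "x \<rightarrow>\<^bsub>H\<^esub> y" "distinct [v, x, y]" "{x, y} \<subseteq> verts H" for x y
    using v
  proof
    assume "source H v"
    then have "v \<rightarrow>\<^bsub>H\<^esub> x"
      using adj that V by (intro source_dominates) auto
    then show ?thesis
      using that V by (intro turn) auto
  next
    assume "sink H v"
    then have "y \<rightarrow>\<^bsub>H\<^esub> v"
      using adj that V by (intro sink_dominated) auto
    then have "right_turn \<sigma> x y v"
      using that V by (intro turn) auto
    moreover have "distinct [x, y, v]"
      using that by auto
    ultimately show ?thesis
      using right_turn_rotate[OF \<sigma>(1)] by blast
  qed
  have "v \<in> verts Q" "c \<noteq> a"
    using V sub d by auto
  then show False
    using no_cyclic_right_turns[OF \<sigma>(1) _ d turn_v turn_v turn_v] abc d V by simp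
qed

end
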